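(* Let $A$ be a Vidinli algebra over a field $\mathbb{F}$ of characteristic not $2$, with norm $q$ and bilinear form $B$, and let $V=\{x\in A\mid q(x,1)=0\}$. Then the Lie algebra of derivations of $A$ is isomorphic, by restriction to $V$, to the Lie algebra of skew endomorphisms relative to $B|_V$: $$\{\delta\in\operatorname{End}_{\mathbb{F}}(V)\mid B(\delta(x),y)+B(x,\delta(y))=0\ \ \forall x,y\in V\}.$$
   Context: Algebras are not necessarily associative: an algebra over a field $\mathbb{F}$ is a vector space with a bilinear multiplication (of arbitrary dimension). Write $[x,y]=xy-yx$. For a quadratic form $q$, its polar form is denoted by the same letter: $q(x,y)=q(x+y)-q(x)-q(y)$. A conic algebra is a unital algebra $A$ (unity $1$) endowed with a quadratic form $q\colon A\to\mathbb{F}$, called the norm, such that $q(1)=1$ and $x^2-q(x,1)x+q(x)1=0$ for all $x\in A$. A Vidinli algebra is a conic algebra $A$ such that $[A,A]\subseteq\mathbb{F}1$. For a Vidinli algebra $A$ with norm $q$ over a field of characteristic not $2$, let $\omega\colon A\times A\to\mathbb{F}$ be the skew-symmetric bilinear form with $[x,y]=\omega(x,y)1$. The bilinear form of the Vidinli algebra is $B\colon A\times A\to\mathbb{F}$, $B(x,y)=\frac12\bigl(q(x,y)-\omega(x,y)\bigr)$. Moreover $A=\mathbb{F}1\oplus V$. *)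

theory Defs
  imports Complex_Main "HOL-Library.FuncSet"
begin

text \<open>The algebra is the whole type \<^typ>\<open>'a\<close>, of arbitrary dimension, with an explicit scalar
  multiplication by the field \<^typ>\<open>'f\<close>; no associativity is assumed.\<close>

locale nonassoc_algebra = vector_space scale
  for scale :: "'f::field \<Rightarrow> 'a::ab_group_add \<Rightarrow> 'a"
  and mul :: "'a \<Rightarrow> 'a \<Rightarrow> 'a" +
  assumes mult_linear_left: "Vector_Spaces.linear scale scale (\<lambda>x. mul x y)"
    and mult_linear_right: "Vector_Spaces.linear scale scale (\<lambda>y. mul x y)"

locale unital_nonassoc_algebra = nonassoc_algebra scale mul
  for scale :: "'f::field \<Rightarrow> 'a::ab_group_add \<Rightarrow> 'a"
  and mul :: "'a \<Rightarrow> 'a \<Rightarrow> 'a" +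
  fixes one :: 'a
  assumes mult_one_left: "mul one x = x"
    and mult_one_right: "mul x one = x"

definition commutator :: "('a \<Rightarrow> 'a \<Rightarrow> 'a) \<Rightarrow> 'a \<Rightarrow> 'a \<Rightarrow> 'a::ab_group_add" where
  "commutator mul x y = mul x y - mul y x"

definition polar :: "('a::ab_group_add \<Rightarrow> 'f::field) \<Rightarrow> 'a \<Rightarrow> 'a \<Rightarrow> 'f" where
  "polar q x y = q (x + y) - q x - q y"

locale quadratic_form = vector_space scale
  for scale :: "'f::field \<Rightarrow> 'a::ab_group_add \<Rightarrow> 'a"
  and q :: "'a \<Rightarrow> 'f" +
  assumes q_scale: "q (scale c x) = c\<^sup>2 * q x"
    and polar_linear_left: "Vector_Spaces.linear scale (*) (\<lambda>x. polar q x y)"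
    and polar_linear_right: "Vector_Spaces.linear scale (*) (\<lambda>y. polar q x y)"

locale conic_algebra = unital_nonassoc_algebra scale mul one + quadratic_form scale q
  for scale :: "'f::field \<Rightarrow> 'a::ab_group_add \<Rightarrow> 'a"
  and mul :: "'a \<Rightarrow> 'a \<Rightarrow> 'a" and one :: 'a and q :: "'a \<Rightarrow> 'f" +
  assumes q_one: "q one = 1"
    and conic: "mul x x - scale (polar q x one) x + scale (q x) one = 0"

locale vidinli_algebra = conic_algebra scale mul one q
  for scale :: "'f::field \<Rightarrow> 'a::ab_group_add \<Rightarrow> 'a"
  and mul :: "'a \<Rightarrow> 'a \<Rightarrow> 'a" and one :: 'a and q :: "'a \<Rightarrow> 'f" +
  assumes commutator_scalar: "commutator mul x y \<in> range (\<lambda>c. scale c one)"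

definition vidinli_omega ::
  "('f::field \<Rightarrow> 'a::ab_group_add \<Rightarrow> 'a) \<Rightarrow> ('a \<Rightarrow> 'a \<Rightarrow> 'a) \<Rightarrow> 'a \<Rightarrow> 'a \<Rightarrow> 'a \<Rightarrow> 'f" where
  "vidinli_omega scale mul one x y = (THE c. commutator mul x y = scale c one)"

definition vidinli_form ::
  "('f::field \<Rightarrow> 'a::ab_group_add \<Rightarrow> 'a) \<Rightarrow> ('a \<Rightarrow> 'a \<Rightarrow> 'a) \<Rightarrow> 'a \<Rightarrow> ('a \<Rightarrow> 'f) \<Rightarrow> 'a \<Rightarrow> 'a \<Rightarrow> 'f" where
  "vidinli_form scale mul one q x y = (1/2) * (polar q x y - vidinli_omega scale mul one x y)"

definition pure_part :: "'a::ab_group_add \<Rightarrow> ('a \<Rightarrow> 'f::field) \<Rightarrow> 'a set" where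
  "pure_part one q = {x. polar q x one = 0}"

context conic_algebra
begin

lemma one_neq_zero: "one \<noteq> 0"
proof
  assume "one = 0"
  then have "q one = 0" using q_scale[of 0 one] by simp
  then show False using q_one by simp
qed

end

text \<open>The definite description in \<^const>\<open>vidinli_omega\<close> is well defined:\<close>

lemma (in vidinli_algebra) commutator_eq_omega:
  "commutator mul x y = scale (vidinli_omega scale mul one x y) one"
proof -
  obtain c where c: "commutator mul x y = scale c one"
    using commutator_scalar by blast
  have "\<exists>!c. commutator mul x y = scale c one"
    using c one_neq_zero by (metis scale_cancel_right)
  then show ?thesis unfolding vidinli_omega_def by (rule theI')
qed

record ('f, 'v) lie_struct =
  lcarrier :: "'v set"
  lzero :: 'v
  ladd :: "'v \<Rightarrow> 'v \<Rightarrow> 'v"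
  lscale :: "'f \<Rightarrow> 'v \<Rightarrow> 'v"
  lbracket :: "'v \<Rightarrow> 'v \<Rightarrow> 'v"

locale lie_algebra =
  fixes L :: "('f::field, 'v) lie_struct"
  assumes zero_closed: "lzero L \<in> lcarrier L"
    and add_closed: "\<lbrakk>x \<in> lcarrier L; y \<in> lcarrier L\<rbrakk> \<Longrightarrow> ladd L x y \<in> lcarrier L"
    and scale_closed: "x \<in> lcarrier L \<Longrightarrow> lscale L c x \<in> lcarrier L"
    and bracket_closed: "\<lbrakk>x \<in> lcarrier L; y \<in> lcarrier L\<rbrakk> \<Longrightarrow> lbracket L x y \<in> lcarrier L"
    and add_assoc: "\<lbrakk>x \<in> lcarrier L; y \<in> lcarrier L; z \<in> lcarrier L\<rbrakk>
      \<Longrightarrow> ladd L (ladd L x y) z = ladd L x (ladd L y z)"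
    and add_commute: "\<lbrakk>x \<in> lcarrier L; y \<in> lcarrier L\<rbrakk> \<Longrightarrow> ladd L x y = ladd L y x"
    and add_zero: "x \<in> lcarrier L \<Longrightarrow> ladd L (lzero L) x = x"
    and add_inverse: "x \<in> lcarrier L \<Longrightarrow> \<exists>y\<in>lcarrier L. ladd L x y = lzero L"
    and scale_add_right: "\<lbrakk>x \<in> lcarrier L; y \<in> lcarrier L\<rbrakk>
      \<Longrightarrow> lscale L c (ladd L x y) = ladd L (lscale L c x) (lscale L c y)"
    and scale_add_left: "x \<in> lcarrier L
      \<Longrightarrow> lscale L (c + d) x = ladd L (lscale L c x) (lscale L d x)"
    and scale_scale: "x \<in> lcarrier L \<Longrightarrow> lscale L c (lscale L d x) = lscale L (c * d) x"
    and scale_one: "x \<in> lcarrier L \<Longrightarrow> lscale L 1 x = x"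
    and bracket_add_left: "\<lbrakk>x \<in> lcarrier L; y \<in> lcarrier L; z \<in> lcarrier L\<rbrakk>
      \<Longrightarrow> lbracket L (ladd L x y) z = ladd L (lbracket L x z) (lbracket L y z)"
    and bracket_add_right: "\<lbrakk>x \<in> lcarrier L; y \<in> lcarrier L; z \<in> lcarrier L\<rbrakk>
      \<Longrightarrow> lbracket L x (ladd L y z) = ladd L (lbracket L x y) (lbracket L x z)"
    and bracket_scale_left: "\<lbrakk>x \<in> lcarrier L; y \<in> lcarrier L\<rbrakk>
      \<Longrightarrow> lbracket L (lscale L c x) y = lscale L c (lbracket L x y)"
    and bracket_scale_right: "\<lbrakk>x \<in> lcarrier L; y \<in> lcarrier L\<rbrakk>
      \<Longrightarrow> lbracket L x (lscale L c y) = lscale L c (lbracket L x y)"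
    and bracket_self: "x \<in> lcarrier L \<Longrightarrow> lbracket L x x = lzero L"
    and jacobi: "\<lbrakk>x \<in> lcarrier L; y \<in> lcarrier L; z \<in> lcarrier L\<rbrakk>
      \<Longrightarrow> ladd L (lbracket L x (lbracket L y z))
            (ladd L (lbracket L y (lbracket L z x)) (lbracket L z (lbracket L x y))) = lzero L"

locale lie_algebra_iso = dom: lie_algebra L + cod: lie_algebra M
  for L :: "('f::field, 'v) lie_struct" and M :: "('f, 'w) lie_struct" and \<phi> :: "'v \<Rightarrow> 'w" +
  assumes bij: "bij_betw \<phi> (lcarrier L) (lcarrier M)"
    and hom_add: "\<lbrakk>x \<in> lcarrier L; y \<in> lcarrier L\<rbrakk> \<Longrightarrow> \<phi> (ladd L x y) = ladd M (\<phi> x) (\<phi> y)"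
    and hom_scale: "x \<in> lcarrier L \<Longrightarrow> \<phi> (lscale L c x) = lscale M c (\<phi> x)"
    and hom_bracket: "\<lbrakk>x \<in> lcarrier L; y \<in> lcarrier L\<rbrakk>
      \<Longrightarrow> \<phi> (lbracket L x y) = lbracket M (\<phi> x) (\<phi> y)"

text \<open>A linear endomorphism of a subspace \<open>U\<close> is represented by the function that
  is \<^const>\<open>undefined\<close> outside \<open>U\<close>, so that equality of functions is equality on \<open>U\<close>.\<close>

definition endomorphisms ::
  "('f::field \<Rightarrow> 'a::ab_group_add \<Rightarrow> 'a) \<Rightarrow> 'a set \<Rightarrow> ('a \<Rightarrow> 'a) set" where
  "endomorphisms scale U = {f \<in> U \<rightarrow>\<^sub>E U.
     (\<forall>x\<in>U. \<forall>y\<in>U. f (x + y) = f x + f y) \<and> (\<forall>c. \<forall>x\<in>U. f (scale c x) = scale c (f x))}"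

definition gl ::
  "('f::field \<Rightarrow> 'a::ab_group_add \<Rightarrow> 'a) \<Rightarrow> 'a set \<Rightarrow> ('f, 'a \<Rightarrow> 'a) lie_struct" where
  "gl scale U = \<lparr>
     lcarrier = endomorphisms scale U,
     lzero = (\<lambda>x\<in>U. 0),
     ladd = (\<lambda>f g. \<lambda>x\<in>U. f x + g x),
     lscale = (\<lambda>c f. \<lambda>x\<in>U. scale c (f x)),
     lbracket = (\<lambda>f g. \<lambda>x\<in>U. f (g x) - g (f x)) \<rparr>"

definition derivation_lie_algebra ::
  "('f::field \<Rightarrow> 'a::ab_group_add \<Rightarrow> 'a) \<Rightarrow> ('a \<Rightarrow> 'a \<Rightarrow> 'a) \<Rightarrow> ('f, 'a \<Rightarrow> 'a) lie_struct" where
  "derivation_lie_algebra scale mul = (gl scale UNIV)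
     \<lparr>lcarrier := {\<delta> \<in> endomorphisms scale UNIV.
        \<forall>x y. \<delta> (mul x y) = mul (\<delta> x) y + mul x (\<delta> y)}\<rparr>"

definition skew_lie_algebra ::
  "('f::field \<Rightarrow> 'a::ab_group_add \<Rightarrow> 'a) \<Rightarrow> 'a set \<Rightarrow> ('a \<Rightarrow> 'a \<Rightarrow> 'f) \<Rightarrow>
     ('f, 'a \<Rightarrow> 'a) lie_struct" where
  "skew_lie_algebra scale U B = (gl scale U)
     \<lparr>lcarrier := {\<delta> \<in> endomorphisms scale U.
        \<forall>x\<in>U. \<forall>y\<in>U. B (\<delta> x) y + B x (\<delta> y) = 0}\<rparr>"

end

theory Submission
  imports Defs
begin

text \<open>
  The theorem rests on one formula. If \<open>x\<close> lies in \<open>V\<close>, the conic identity reads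
  \<open>x\<^sup>2 = - q(x) 1\<close>; polarizing it gives \<open>xy + yx = - q(x,y) 1\<close> on \<open>V\<close>, and adding
  \<open>xy - yx = \<omega>(x,y) 1\<close> yields \<open>xy = - B(x,y) 1\<close> (lemma \<open>mul_pure\<close>). So \<open>A = \<F>1 \<oplus> V\<close> is the
  algebra whose multiplication is determined by its unit and by \<open>B\<close> on \<open>V\<close>.

  A derivation \<open>\<delta>\<close> kills \<open>1\<close>. It also preserves \<open>V\<close>: differentiating \<open>x\<^sup>2 \<in> \<F>1\<close> gives
  \<open>\<delta>(x) x + x \<delta>(x) = 0\<close>, and if \<open>\<delta>(x)\<close> had scalar part \<open>a \<noteq> 0\<close>, the left-hand side would be
  \<open>2 a x\<close> plus a scalar, which is nonzero for \<open>0 \<noteq> x \<in> V\<close>. Differentiating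
  \<open>xy = - B(x,y) 1\<close> then says exactly that \<open>\<delta>\<close> is skew on \<open>V\<close>. Conversely a skew endomorphism
  of \<open>V\<close>, extended by \<open>0\<close> on \<open>1\<close>, satisfies the Leibniz rule on products of two elements of
  \<open>V\<close> by the same formula, and on products with \<open>1\<close> trivially. Since \<open>1\<close> and \<open>V\<close> span \<open>A\<close>,
  restriction is a bijection; it is compatible with the Lie operations since these are
  computed pointwise and \<open>V\<close> is invariant.
\<close>

section \<open>Lie algebras of endomorphisms of a subspace\<close>

text \<open>Negation is not part of the structure, so closure under additive inverses has to come
  from \<open>x + (-1) x = 0 x = 0\<close>.\<close>

lemma (in lie_algebra) lie_subalgebra:
  assumes sub: "S \<subseteq> lcarrier L" and zero: "lzero L \<in> S"
    and add: "\<And>x y. x \<in> S \<Longrightarrow> y \<in> S \<Longrightarrow> ladd L x y \<in> S"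
    and scl: "\<And>c x. x \<in> S \<Longrightarrow> lscale L c x \<in> S"
    and brk: "\<And>x y. x \<in> S \<Longrightarrow> y \<in> S \<Longrightarrow> lbracket L x y \<in> S"
  shows "lie_algebra (L\<lparr>lcarrier := S\<rparr>)"
proof -
  have inv: "\<exists>y\<in>S. ladd L x y = lzero L" if x: "x \<in> S" for x
  proof -
    have xL: "x \<in> lcarrier L" using x sub by blast
    let ?z = "lscale L 0 x"
    have zL: "?z \<in> lcarrier L" using xL by (rule scale_closed)
    have zz: "ladd L ?z ?z = ?z" using scale_add_left[OF xL, of 0 0] by simp
    obtain y where y: "y \<in> lcarrier L" "ladd L ?z y = lzero L"
      using add_inverse[OF zL] by blast
    have "ladd L ?z (ladd L ?z y) = ladd L ?z y"
      using add_assoc[OF zL zL y(1)] zz by simp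
    then have "?z = lzero L"
      using y add_commute[OF zL zero_closed] add_zero[OF zL] by simp
    moreover have "ladd L x (lscale L (-1) x) = ?z"
      using scale_add_left[OF xL, of 1 "-1"] scale_one[OF xL] by simp
    ultimately show ?thesis using scl[OF x] by metis
  qed
  show ?thesis
    by unfold_locales
      (use sub zero add scl brk inv in \<open>simp_all add: subset_iff add_assoc add_zero
        scale_add_right scale_add_left scale_scale scale_one bracket_add_left bracket_add_right
        bracket_scale_left bracket_scale_right bracket_self jacobi\<close>,
        meson add_commute sub subsetD)
qed

lemma endomorphismsD:
  assumes "f \<in> endomorphisms scale U"
  shows "x \<in> U \<Longrightarrow> f x \<in> U" and "x \<in> U \<Longrightarrow> y \<in> U \<Longrightarrow> f (x + y) = f x + f y"
    and "x \<in> U \<Longrightarrow> f (scale c x) = scale c (f x)" and "x \<notin> U \<Longrightarrow> f x = undefined"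
  using assms by (auto simp: endomorphisms_def PiE_def extensional_def)

context vector_space
begin

lemma endomorphism_diff:
  assumes "subspace U" "f \<in> endomorphisms scale U" "x \<in> U" "y \<in> U"
  shows "f (x - y) = f x - f y"
  using endomorphismsD(2)[OF assms(2) subspace_diff[OF assms(1,3,4)] assms(4)]
  by (simp add: algebra_simps)

lemma lie_algebra_gl:
  assumes U: "subspace U"
  shows "lie_algebra (gl scale U)"
proof
  note cl = subspace_0[OF U] subspace_add[OF U] subspace_scale[OF U] subspace_diff[OF U]
  show "lzero (gl scale U) \<in> lcarrier (gl scale U)"
    by (auto simp: gl_def endomorphisms_def cl)
  show "ladd (gl scale U) f g \<in> lcarrier (gl scale U)"
    if "f \<in> lcarrier (gl scale U)" "g \<in> lcarrier (gl scale U)" for f g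
    using that by (auto simp: gl_def endomorphisms_def cl scale_right_distrib PiE_iff)
  show scl: "lscale (gl scale U) c f \<in> lcarrier (gl scale U)"
    if "f \<in> lcarrier (gl scale U)" for c f
    using that by (auto simp: gl_def endomorphisms_def cl scale_right_distrib PiE_iff mult.commute)
  show "lbracket (gl scale U) f g \<in> lcarrier (gl scale U)"
    if "f \<in> lcarrier (gl scale U)" "g \<in> lcarrier (gl scale U)" for f g
    using that by (auto simp: gl_def endomorphisms_def cl scale_right_diff_distrib PiE_iff)
  show "\<exists>g\<in>lcarrier (gl scale U). ladd (gl scale U) f g = lzero (gl scale U)"
    if "f \<in> lcarrier (gl scale U)" for f
    by (rule bexI[OF _ scl[OF that, of "-1"]]) (auto simp: gl_def fun_eq_iff)
  show "ladd (gl scale U) (lzero (gl scale U)) f = f" if "f \<in> lcarrier (gl scale U)" for f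
    using that by (auto simp: gl_def fun_eq_iff endomorphismsD(4))
  show "lscale (gl scale U) 1 f = f" if "f \<in> lcarrier (gl scale U)" for f
    using that by (auto simp: gl_def fun_eq_iff endomorphismsD(4))
qed (auto simp: gl_def fun_eq_iff algebra_simps endomorphismsD(1,2,3)[of _ scale U]
    subspace_0[OF U] subspace_add[OF U] subspace_scale[OF U] subspace_diff[OF U]
    endomorphism_diff[OF U])

end

section \<open>The product on the pure part\<close>

context nonassoc_algebra
begin

lemma mul_add_left: "mul (x + y) z = mul x z + mul y z"
  and mul_scale_left: "mul (scale c x) z = scale c (mul x z)"
  using mult_linear_left[of z] by (auto simp: Vector_Spaces.linear_iff)

lemma mul_add_right: "mul z (x + y) = mul z x + mul z y"
  and mul_scale_right: "mul z (scale c x) = scale c (mul z x)"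
  using mult_linear_right[of z] by (auto simp: Vector_Spaces.linear_iff)

lemma mul_diff_left: "mul (x - y) z = mul x z - mul y z"
  using mul_add_left[of "x - y" y z] by simp

lemma mul_diff_right: "mul z (x - y) = mul z x - mul z y"
  using mul_add_right[of z "x - y" y] by simp

lemma derivationD:
  assumes "\<delta> \<in> lcarrier (derivation_lie_algebra scale mul)"
  shows "\<delta> (x + y) = \<delta> x + \<delta> y"
    and "\<delta> (scale c x) = scale c (\<delta> x)" and "\<delta> (mul x y) = mul (\<delta> x) y + mul x (\<delta> y)"
  using assms by (auto simp: derivation_lie_algebra_def endomorphisms_def)

lemma lie_algebra_derivations: "lie_algebra (derivation_lie_algebra scale mul)"
proof -
  interpret gl: lie_algebra "gl scale UNIV" by (rule lie_algebra_gl[OF subspace_UNIV])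
  let ?S = "{\<delta> \<in> endomorphisms scale UNIV. \<forall>x y. \<delta> (mul x y) = mul (\<delta> x) y + mul x (\<delta> y)}"
  have add: "f (x + y) = f x + f y" if "f \<in> endomorphisms scale UNIV" for f x y
    using that by (auto simp: endomorphisms_def)
  have car: "lcarrier (gl scale UNIV) = endomorphisms scale UNIV" by (simp add: gl_def)
  show ?thesis
    unfolding derivation_lie_algebra_def
  proof (rule gl.lie_subalgebra)
    show "lzero (gl scale UNIV) \<in> ?S"
      using gl.zero_closed mul_scale_left[of 0] mul_scale_right[of _ 0]
      by (auto simp: car) (auto simp: gl_def)
    show "ladd (gl scale UNIV) f g \<in> ?S" if "f \<in> ?S" "g \<in> ?S" for f g
      using that gl.add_closed[of f g]
      by (auto simp: car) (auto simp: gl_def mul_add_left mul_add_right algebra_simps)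
    show "lscale (gl scale UNIV) c f \<in> ?S" if "f \<in> ?S" for c f
      using that gl.scale_closed[of f c]
      by (auto simp: car) (auto simp: gl_def mul_scale_left mul_scale_right algebra_simps)
    show "lbracket (gl scale UNIV) f g \<in> ?S" if "f \<in> ?S" "g \<in> ?S" for f g
      using that gl.bracket_closed[of f g]
      by (auto simp: car) (auto simp: gl_def mul_diff_left mul_diff_right add algebra_simps)
  qed (auto simp: car)
qed

end

locale vidinli_algebra_char_not_2 = vidinli_algebra scale mul one q
  for scale :: "'f::field \<Rightarrow> 'a::ab_group_add \<Rightarrow> 'a"
  and mul :: "'a \<Rightarrow> 'a \<Rightarrow> 'a" and one :: 'a and q :: "'a \<Rightarrow> 'f" +
  assumes char_not_2: "CHAR('f) \<noteq> 2"
begin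

abbreviation "V \<equiv> pure_part one q"
abbreviation "B \<equiv> vidinli_form scale mul one q"

definition scalar_part :: "'a \<Rightarrow> 'f" where
  "scalar_part x = polar q x one / 2"

definition vector_part :: "'a \<Rightarrow> 'a" where
  "vector_part x = x - scale (scalar_part x) one"

lemma two_neq_zero: "(2::'f) \<noteq> 0"
proof
  assume "(2::'f) = 0"
  then have "of_nat 2 = (0::'f)" by simp
  then have "CHAR('f) dvd 2" by (simp only: of_nat_eq_0_iff_char_dvd)
  moreover from this have "CHAR('f) \<le> 2" by (rule dvd_imp_le) simp
  moreover from this have "CHAR('f) \<noteq> 1" "CHAR('f) \<noteq> 2" using char_not_2 CHAR_not_1 by auto
  ultimately have "CHAR('f) = 0" by linarith
  with \<open>CHAR('f) dvd 2\<close> show False by simp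
qed

lemma polar_one_add: "polar q (x + y) one = polar q x one + polar q y one"
  and polar_one_scale: "polar q (scale c x) one = c * polar q x one"
  using polar_linear_left[of one] by (auto simp: Vector_Spaces.linear_iff)

lemma scalar_part_add: "scalar_part (x + y) = scalar_part x + scalar_part y"
  and scalar_part_scale: "scalar_part (scale c x) = c * scalar_part x"
  by (simp_all add: scalar_part_def polar_one_add polar_one_scale add_divide_distrib)

lemma pure_iff: "x \<in> V \<longleftrightarrow> scalar_part x = 0"
  using two_neq_zero by (simp add: pure_part_def scalar_part_def)

lemma scalar_part_one: "scalar_part one = 1"
proof -
  have "one + one = scale 2 one"
    using scale_left_distrib[of 1 1 one] by simp
  then have "polar q one one = 2\<^sup>2 - 1 - 1"
    by (simp add: polar_def q_scale q_one)
  then show ?thesis using two_neq_zero by (simp add: scalar_part_def power2_eq_square)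
qed

lemma scalar_part_diff: "scalar_part (x - y) = scalar_part x - scalar_part y"
  using scalar_part_add[of "x - y" y] by simp

lemma subspace_pure: "subspace V"
  using scalar_part_scale[of 0 0]
  by (auto simp: subspace_def pure_iff scalar_part_add scalar_part_scale)

lemma decomposition: "x = scale (scalar_part x) one + vector_part x"
  by (simp add: vector_part_def)

lemma vector_part_pure: "vector_part x \<in> V"
  by (simp add: pure_iff vector_part_def scalar_part_diff scalar_part_scale scalar_part_one)

lemma vector_part_of_pure: "x \<in> V \<Longrightarrow> vector_part x = x"
  by (simp add: pure_iff vector_part_def)

lemma vector_part_add: "vector_part (x + y) = vector_part x + vector_part y"
  by (simp add: vector_part_def scalar_part_add algebra_simps)

lemma vector_part_scale: "vector_part (scale c x) = scale c (vector_part x)"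
  by (simp add: vector_part_def scalar_part_scale algebra_simps)

lemma square_pure:
  assumes "x \<in> V"
  shows "mul x x = scale (- q x) one"
  using conic[of x] assms by (simp add: pure_part_def eq_neg_iff_add_eq_0)

text \<open>The sum and the difference of \<open>xy\<close> and \<open>yx\<close> are both scalar: the sum by polarizing
  \<open>x\<^sup>2 = - q(x) 1\<close>, the difference since commutators are scalar. Halving the total explains
  the factor \<open>1/2\<close> and the sign of \<open>\<omega>\<close> in the definition of \<open>B\<close>.\<close>

lemma mul_pure:
  assumes x: "x \<in> V" and y: "y \<in> V"
  shows "mul x y = scale (- B x y) one"
proof -
  have xy: "x + y \<in> V" using subspace_add[OF subspace_pure x y] .
  have "mul x y + mul y x = mul (x + y) (x + y) - mul x x - mul y y"
    by (simp add: mul_add_left mul_add_right)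
  also have "\<dots> = scale (- polar q x y) one"
    by (simp add: square_pure x y xy polar_def algebra_simps)
  finally have sum: "mul x y + mul y x = scale (- polar q x y) one" .
  have "mul x y - mul y x = scale (vidinli_omega scale mul one x y) one"
    using commutator_eq_omega[of x y] by (simp add: commutator_def)
  with sum have "(mul x y + mul y x) + (mul x y - mul y x)
      = scale (vidinli_omega scale mul one x y - polar q x y) one"
    by (simp add: algebra_simps)
  then have "scale 2 (mul x y) = scale (vidinli_omega scale mul one x y - polar q x y) one"
    using scale_left_distrib[of 1 1 "mul x y"] by simp
  then have "scale (1/2) (scale 2 (mul x y))
      = scale (1/2) (scale (vidinli_omega scale mul one x y - polar q x y) one)" by simp
  then show ?thesis
    using two_neq_zero by (simp add: vidinli_form_def algebra_simps)
qed

lemma scale_one_eq_iff: "scale a one = scale b one \<longleftrightarrow> a = b"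
  using one_neq_zero by simp

text \<open>Bilinearity of \<open>B\<close> on \<open>V\<close> is inherited from the product, since \<open>1 \<noteq> 0\<close> allows
  coefficients of \<open>1\<close> to be compared in \<open>xy = - B(x,y) 1\<close>.\<close>

lemma form_add_left: "x \<in> V \<Longrightarrow> y \<in> V \<Longrightarrow> z \<in> V \<Longrightarrow> B (x + y) z = B x z + B y z"
  and form_add_right: "x \<in> V \<Longrightarrow> y \<in> V \<Longrightarrow> z \<in> V \<Longrightarrow> B z (x + y) = B z x + B z y"
  and form_scale_left: "x \<in> V \<Longrightarrow> z \<in> V \<Longrightarrow> B (scale c x) z = c * B x z"
  and form_scale_right: "x \<in> V \<Longrightarrow> z \<in> V \<Longrightarrow> B z (scale c x) = c * B z x"
proof -
  note cl = subspace_add[OF subspace_pure] subspace_scale[OF subspace_pure]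
  have *: "B u v = c" if "u \<in> V" "v \<in> V" "mul u v = scale (- c) one" for u v c
    using mul_pure[OF that(1,2)] that(3) scale_one_eq_iff by simp
  show "B (x + y) z = B x z + B y z" if "x \<in> V" "y \<in> V" "z \<in> V"
    by (rule *) (simp_all add: that cl mul_add_left mul_pure algebra_simps)
  show "B z (x + y) = B z x + B z y" if "x \<in> V" "y \<in> V" "z \<in> V"
    by (rule *) (simp_all add: that cl mul_add_right mul_pure algebra_simps)
  show "B (scale c x) z = c * B x z" if "x \<in> V" "z \<in> V"
    by (rule *) (simp_all add: that cl mul_scale_left mul_pure)
  show "B z (scale c x) = c * B z x" if "x \<in> V" "z \<in> V"
    by (rule *) (simp_all add: that cl mul_scale_right mul_pure)
qed

lemma form_diff_left: "x \<in> V \<Longrightarrow> y \<in> V \<Longrightarrow> z \<in> V \<Longrightarrow> B (x - y) z = B x z - B y z"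
  using form_add_left[of "x - y" y z] subspace_diff[OF subspace_pure] by simp

lemma form_diff_right: "x \<in> V \<Longrightarrow> y \<in> V \<Longrightarrow> z \<in> V \<Longrightarrow> B z (x - y) = B z x - B z y"
  using form_add_right[of "x - y" y z] subspace_diff[OF subspace_pure] by simp

section \<open>Skew endomorphisms of the pure part\<close>

lemma skewD:
  assumes "f \<in> lcarrier (skew_lie_algebra scale V B)"
  shows "f \<in> endomorphisms scale V" and "x \<in> V \<Longrightarrow> y \<in> V \<Longrightarrow> B (f x) y + B x (f y) = 0"
  using assms by (auto simp: skew_lie_algebra_def)

lemma lie_algebra_skew: "lie_algebra (skew_lie_algebra scale V B)"
proof -
  interpret gl: lie_algebra "gl scale V" by (rule lie_algebra_gl[OF subspace_pure])
  let ?S = "{\<delta> \<in> endomorphisms scale V. \<forall>x\<in>V. \<forall>y\<in>V. B (\<delta> x) y + B x (\<delta> y) = 0}"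
  have car: "lcarrier (gl scale V) = endomorphisms scale V" by (simp add: gl_def)
  note cl = subspace_0[OF subspace_pure] subspace_add[OF subspace_pure]
    subspace_scale[OF subspace_pure] subspace_diff[OF subspace_pure]
  have mem: "f x \<in> V" if "f \<in> endomorphisms scale V" "x \<in> V" for f x
    using endomorphismsD(1)[OF that] .
  show ?thesis
    unfolding skew_lie_algebra_def
  proof (rule gl.lie_subalgebra)
    have "B 0 y = 0" "B y 0 = 0" if "y \<in> V" for y
      using that form_scale_left[of 0 y 0] form_scale_right[of 0 y 0] cl(1) by simp_all
    then show "lzero (gl scale V) \<in> ?S"
      using gl.zero_closed by (auto simp: car) (auto simp: gl_def)
    show "ladd (gl scale V) f g \<in> ?S" if fg: "f \<in> ?S" "g \<in> ?S" for f g
    proof -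
      have E: "f \<in> endomorphisms scale V" "g \<in> endomorphisms scale V" using fg by auto
      have "B (f x + g x) y + B x (f y + g y) = 0" if "x \<in> V" "y \<in> V" for x y
      proof -
        have "B (f x + g x) y + B x (f y + g y) = (B (f x) y + B x (f y)) + (B (g x) y + B x (g y))"
          using E that by (simp add: form_add_left form_add_right mem algebra_simps)
        then show ?thesis using fg that by simp
      qed
      then show ?thesis using fg gl.add_closed[of f g] by (auto simp: car) (auto simp: gl_def)
    qed
    show "lscale (gl scale V) c f \<in> ?S" if f: "f \<in> ?S" for c f
    proof -
      have E: "f \<in> endomorphisms scale V" using f by auto
      have "B (scale c (f x)) y + B x (scale c (f y)) = 0" if "x \<in> V" "y \<in> V" for x y
      proof -
        have "B (scale c (f x)) y + B x (scale c (f y)) = c * (B (f x) y + B x (f y))"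
          using E that by (simp add: form_scale_left form_scale_right mem algebra_simps)
        then show ?thesis using f that by simp
      qed
      then show ?thesis using f gl.scale_closed[of f c] by (auto simp: car) (auto simp: gl_def)
    qed
    show "lbracket (gl scale V) f g \<in> ?S" if fg: "f \<in> ?S" "g \<in> ?S" for f g
    proof -
      have flip: "B (h x) y = - B x (h y)" if "h \<in> ?S" "x \<in> V" "y \<in> V" for h x y
        using that by (simp add: eq_neg_iff_add_eq_0)
      have "B (f (g x) - g (f x)) y + B x (f (g y) - g (f y)) = 0" if "x \<in> V" "y \<in> V" for x y
        using fg that
        by (simp add: form_diff_left form_diff_right mem flip[OF fg(1)] flip[OF fg(2)])
      then show ?thesis using fg gl.bracket_closed[of f g] by (auto simp: car) (auto simp: gl_def)
    qed
  qed (auto simp: car)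
qed

section \<open>Restriction and extension\<close>

lemma derivation_one:
  assumes "\<delta> \<in> lcarrier (derivation_lie_algebra scale mul)"
  shows "\<delta> one = 0"
  using derivationD(3)[OF assms, of one one] by (simp add: mult_one_left mult_one_right)

text \<open>Comparing components along \<open>\<F>1 \<oplus> V\<close> in \<open>\<delta>(x) x + x \<delta>(x) = 0\<close>: the \<open>V\<close>-component of
  the left-hand side is \<open>2 a x\<close>, where \<open>a\<close> is the scalar part of \<open>\<delta>(x)\<close>.\<close>

lemma derivation_pure:
  assumes d: "\<delta> \<in> lcarrier (derivation_lie_algebra scale mul)" and x: "x \<in> V"
  shows "\<delta> x \<in> V"
proof (cases "x = 0")
  case True
  then show ?thesis
    using derivationD(2)[OF d, of 0 0] subspace_0[OF subspace_pure] by simp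
next
  case False
  define a where "a = scalar_part (\<delta> x)"
  define v where "v = vector_part (\<delta> x)"
  have dx: "\<delta> x = scale a one + v" and v: "v \<in> V"
    unfolding a_def v_def by (rule decomposition, rule vector_part_pure)
  have "\<delta> (mul x x) = 0"
    unfolding square_pure[OF x] derivationD(2)[OF d] derivation_one[OF d] by simp
  then have "mul (\<delta> x) x + mul x (\<delta> x) = 0" by (simp add: derivationD(3)[OF d])
  then have "scale (2 * a) x + scale (- B v x - B x v) one = 0"
    unfolding dx
    using scale_left_distrib[of a a x]
    by (simp add: mul_add_left mul_add_right mul_scale_left mul_scale_right mult_one_left
        mult_one_right mul_pure v x algebra_simps)
  then have eq: "scale (2 * a) x = scale (B v x + B x v) one"
    by (simp add: algebra_simps)
  \<comment> \<open>The two sides lie in \<open>V\<close> and in \<open>\<F>1\<close>, so both vanish.\<close>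
  have "B v x + B x v = scalar_part (scale (2 * a) x)"
    by (simp add: eq scalar_part_scale scalar_part_one)
  also have "\<dots> = 0" using x by (simp add: scalar_part_scale pure_iff)
  finally have "scale (2 * a) x = 0" using eq by simp
  then have "a = 0" using False two_neq_zero by simp
  then show ?thesis by (simp add: pure_iff a_def)
qed

lemma restrict_derivation_skew:
  assumes d: "\<delta> \<in> lcarrier (derivation_lie_algebra scale mul)"
  shows "restrict \<delta> V \<in> lcarrier (skew_lie_algebra scale V B)"
proof -
  note P = derivation_pure[OF d]
  have "B (\<delta> x) y + B x (\<delta> y) = 0" if x: "x \<in> V" and y: "y \<in> V" for x y
  proof -
    have "scale (- B (\<delta> x) y - B x (\<delta> y)) one = mul (\<delta> x) y + mul x (\<delta> y)"
      by (simp add: mul_pure P x y algebra_simps)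
    also have "\<dots> = \<delta> (mul x y)" by (rule derivationD(3)[OF d, symmetric])
    also have "\<dots> = scale 0 one"
      by (simp only: mul_pure[OF x y] derivationD(2)[OF d] derivation_one[OF d] scale_zero_left
          scale_zero_right)
    finally have "- B (\<delta> x) y - B x (\<delta> y) = 0" by (simp only: scale_one_eq_iff)
    moreover have "B (\<delta> x) y + B x (\<delta> y) = - (- B (\<delta> x) y - B x (\<delta> y))" by simp
    ultimately show ?thesis by simp
  qed
  then show ?thesis
    using P subspace_add[OF subspace_pure] subspace_scale[OF subspace_pure]
    by (auto simp: skew_lie_algebra_def endomorphisms_def derivationD(1,2)[OF d])
qed

lemma restrict_derivation_inj:
  "inj_on (\<lambda>\<delta>. restrict \<delta> V) (lcarrier (derivation_lie_algebra scale mul))"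
proof (rule inj_onI, rule ext)
  fix d e x
  assume d: "d \<in> lcarrier (derivation_lie_algebra scale mul)"
    and e: "e \<in> lcarrier (derivation_lie_algebra scale mul)"
    and eq: "restrict d V = restrict e V"
  have "d (vector_part x) = e (vector_part x)"
    using fun_cong[OF eq, of "vector_part x"] vector_part_pure by simp
  then have "d (scale (scalar_part x) one + vector_part x)
      = e (scale (scalar_part x) one + vector_part x)"
    by (simp only: derivationD(1,2)[OF d] derivationD(1,2)[OF e] derivation_one[OF d]
        derivation_one[OF e])
  then show "d x = e x" by (simp flip: decomposition)
qed

text \<open>Extending by \<open>0\<close> on \<open>1\<close> is forced by \<open>\<delta>(1) = 0\<close>. In \<open>\<delta>((a + v)(b + w))\<close> the scalar
  terms vanish and \<open>a \<delta>(w) + b \<delta>(v)\<close> remains, while the two Leibniz terms exceed this by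
  \<open>- (B(\<delta>(v),w) + B(v,\<delta>(w))) 1\<close>, which skewness cancels.\<close>

lemma extend_skew_derivation:
  assumes f: "f \<in> lcarrier (skew_lie_algebra scale V B)"
  shows "(\<lambda>x. f (vector_part x)) \<in> lcarrier (derivation_lie_algebra scale mul)"
proof -
  have E: "f \<in> endomorphisms scale V" by (rule skewD(1)[OF f])
  note D = endomorphismsD[OF E] and W = vector_part_pure
  have "f (vector_part (mul x y)) = mul (f (vector_part x)) y + mul x (f (vector_part y))" for x y
  proof -
    define a b v w where "a = scalar_part x" and "b = scalar_part y"
      and "v = vector_part x" and "w = vector_part y"
    have x: "x = scale a one + v" and y: "y = scale b one + w" and v: "v \<in> V" and w: "w \<in> V"
      unfolding a_def b_def v_def w_def by (rule decomposition, rule decomposition, rule W, rule W)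
    have "mul x y = scale (a * b - B v w) one + (scale a w + scale b v)"
      unfolding x y
      by (simp add: mul_add_left mul_add_right mul_scale_left mul_scale_right mult_one_left
          mult_one_right mul_pure v w algebra_simps)
    moreover have "vector_part one = 0" by (simp add: vector_part_def scalar_part_one)
    ultimately have "vector_part (mul x y) = scale a w + scale b v"
      by (simp add: vector_part_add vector_part_scale vector_part_of_pure v w)
    then have 1: "f (vector_part (mul x y)) = scale a (f w) + scale b (f v)"
      using v w subspace_scale[OF subspace_pure] by (simp add: D)
    have "mul (f v) y + mul x (f w)
        = scale a (f w) + scale b (f v) + scale (- (B (f v) w + B v (f w))) one"
      unfolding x y
      by (simp add: mul_add_left mul_add_right mul_scale_left mul_scale_right mult_one_left
          mult_one_right mul_pure v w D(1) algebra_simps)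
    also have "\<dots> = scale a (f w) + scale b (f v)"
      using skewD(2)[OF f v w] by simp
    finally show ?thesis using 1 unfolding v_def w_def by simp
  qed
  then show ?thesis
    by (simp add: derivation_lie_algebra_def endomorphisms_def vector_part_add vector_part_scale
        W D(2,3))
qed

lemma bij_betw_restrict_derivation:
  "bij_betw (\<lambda>\<delta>. restrict \<delta> V) (lcarrier (derivation_lie_algebra scale mul))
    (lcarrier (skew_lie_algebra scale V B))"
proof -
  have "f \<in> (\<lambda>\<delta>. restrict \<delta> V) ` lcarrier (derivation_lie_algebra scale mul)"
    if f: "f \<in> lcarrier (skew_lie_algebra scale V B)" for f
  proof (rule image_eqI[OF _ extend_skew_derivation[OF f]])
    show "f = restrict (\<lambda>x. f (vector_part x)) V"
      using endomorphismsD(4)[OF skewD(1)[OF f]] by (auto simp: fun_eq_iff vector_part_of_pure)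
  qed
  then show ?thesis
    unfolding bij_betw_def using restrict_derivation_inj restrict_derivation_skew by blast
qed

end

theorem theorem3p10:
  fixes scale :: "'f::field \<Rightarrow> 'a::ab_group_add \<Rightarrow> 'a"
    and mul :: "'a \<Rightarrow> 'a \<Rightarrow> 'a" and one :: 'a and q :: "'a \<Rightarrow> 'f"
  assumes "CHAR('f) \<noteq> 2"
    and "vidinli_algebra scale mul one q"
  shows "lie_algebra_iso
    (derivation_lie_algebra scale mul)
    (skew_lie_algebra scale (pure_part one q) (vidinli_form scale mul one q))
    (\<lambda>\<delta>. restrict \<delta> (pure_part one q))"
proof -
  interpret vidinli_algebra_char_not_2 scale mul one q
    using assms by (simp add: vidinli_algebra_char_not_2_def vidinli_algebra_char_not_2_axioms_def)
  show ?thesis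
  proof (intro lie_algebra_iso.intro lie_algebra_iso_axioms.intro
      lie_algebra_derivations lie_algebra_skew bij_betw_restrict_derivation)
    \<comment> \<open>The bracket on the right composes the restricted maps, so the two sides agree only because \<open>V\<close> is invariant.\<close>
    show "restrict (lbracket (derivation_lie_algebra scale mul) d e) V
        = lbracket (skew_lie_algebra scale V B) (restrict d V) (restrict e V)"
      if "d \<in> lcarrier (derivation_lie_algebra scale mul)"
        "e \<in> lcarrier (derivation_lie_algebra scale mul)" for d e
      using derivation_pure[OF that(1)] derivation_pure[OF that(2)]
      by (auto simp: derivation_lie_algebra_def skew_lie_algebra_def gl_def fun_eq_iff)
  qed (auto simp: derivation_lie_algebra_def skew_lie_algebra_def gl_def fun_eq_iff)
qed

end
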